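(* Let $k\ge 2$ be an integer. If both graphs $G$ and $H$ admit a neighborhood-balanced $k$-coloring, then their lexicographic product $G[H]$ admits a neighborhood-balanced $k$-coloring.
   Context: All graphs are finite, simple and undirected. A neighborhood-balanced $k$-coloring of a graph is a (not necessarily proper) vertex coloring with colors $1,\dots,k$ such that every vertex has the same number of neighbors of each of the $k$ colors. The lexicographic product $G[H]$ has vertex set $V(G)\times V(H)$, and $(u,v)$ and $(u',v')$ are adjacent if and only if either $uu'\in E(G)$, or $u=u'$ and $vv'\in E(H)$. *)

theory Defs
  imports "Graph_Theory.Pair_Digraph"
begin

text \<open>
  A finite simple undirected graph is a \<open>pair_graph\<close>: a finite loop-free digraph without parallel
  arcs whose arc relation is symmetric, an undirected edge being a pair of opposite arcs.
\<close>

definition neighbors :: "'a pair_pre_digraph \<Rightarrow> 'a \<Rightarrow> 'a set" where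
  "neighbors G v = {w \<in> pverts G. (v, w) \<in> parcs G}"

text \<open>
  Values of the coloring outside the vertex set are irrelevant.
\<close>

definition neighborhood_balanced_coloring ::
    "nat \<Rightarrow> 'a pair_pre_digraph \<Rightarrow> ('a \<Rightarrow> nat) \<Rightarrow> bool" where
  "neighborhood_balanced_coloring k G c \<longleftrightarrow>
     (\<forall>v\<in>pverts G. c v \<in> {1..k}) \<and>
     (\<forall>v\<in>pverts G. \<forall>i\<in>{1..k}. \<forall>j\<in>{1..k}.
        card {w \<in> neighbors G v. c w = i} = card {w \<in> neighbors G v. c w = j})"

definition admits_neighborhood_balanced_coloring :: "nat \<Rightarrow> 'a pair_pre_digraph \<Rightarrow> bool" where
  "admits_neighborhood_balanced_coloring k G \<longleftrightarrow>
     (\<exists>c. neighborhood_balanced_coloring k G c)"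

definition lex_product ::
    "'a pair_pre_digraph \<Rightarrow> 'b pair_pre_digraph \<Rightarrow> ('a \<times> 'b) pair_pre_digraph" where
  "lex_product G H =
     \<lparr> pverts = pverts G \<times> pverts H,
       parcs = {((u, v), (u', v')) | u v u' v'.
         (u, v) \<in> pverts G \<times> pverts H \<and> (u', v') \<in> pverts G \<times> pverts H \<and>
         ((u, u') \<in> parcs G \<or> u = u' \<and> (v, v') \<in> parcs H)} \<rparr>"

lemma pair_graph_lex_product:
  assumes "pair_graph G" and "pair_graph H"
  shows "pair_graph (lex_product G H)"
proof -
  interpret G: pair_graph G by fact
  interpret H: pair_graph H by fact
  let ?V = "pverts G \<times> pverts H"
  have fin: "finite ?V"
    using G.pair_finite_verts H.pair_finite_verts by simp
  have sub: "parcs (lex_product G H) \<subseteq> ?V \<times> ?V"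
    by (auto simp: lex_product_def)
  have symG: "(y, x) \<in> parcs G" if "(x, y) \<in> parcs G" for x y
    using G.pair_sym_arcs that by (auto simp: symmetric_def dest: symD)
  have symH: "(y, x) \<in> parcs H" if "(x, y) \<in> parcs H" for x y
    using H.pair_sym_arcs that by (auto simp: symmetric_def dest: symD)
  show ?thesis
  proof
    show "finite (pverts (lex_product G H))"
      using fin by (simp add: lex_product_def)
    show "finite (parcs (lex_product G H))"
      using sub fin by (meson finite_SigmaI finite_subset)
    show "symmetric (with_proj (lex_product G H))"
      using symG symH by (auto simp: symmetric_def lex_product_def intro!: symI)
    show "fst e \<noteq> snd e" if "e \<in> parcs (lex_product G H)" for e
      using that G.pair_no_loops H.pair_no_loops by (fastforce simp: lex_product_def)
  qed (auto simp: lex_product_def)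
qed

end

theory Submission
  imports Defs
begin

text \<open>
  Read the colors modulo \<open>k\<close> and color \<open>(x, y)\<close> by the sum of the colors of \<open>x\<close> and \<open>y\<close>.
  The neighborhood of \<open>(u, v)\<close> is the disjoint union of the copies \<open>N(u) \<times> {y}\<close>, one for each
  vertex \<open>y\<close> of \<open>H\<close>, and of the copy \<open>{u} \<times> N(v)\<close>. On each of these copies one summand is
  constant, so the coloring is a cyclic shift of the given coloring of \<open>N(u)\<close> or \<open>N(v)\<close>. A cyclic
  shift permutes the colors, hence keeps a balanced coloring balanced
  (\<open>card_shifted_color_class_eq\<close>), and a disjoint union of balanced pieces is balanced.
  The product coloring that keeps only the color of \<open>y\<close> would not do: the pieces
  \<open>{x} \<times> V(H)\<close> need not be balanced, since a neighborhood-balanced coloring may have color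
  classes of different sizes, for instance when \<open>H\<close> has isolated vertices.
\<close>

lemma inj_on_color_shift: "inj_on (\<lambda>a. (a + s) mod k + 1) {1..k::nat}"
proof (rule linorder_inj_onI')
  fix a b assume "a \<in> {1..k}" "b \<in> {1..k}" and "a < b"
  then have "\<not> k dvd (b + s) - (a + s)"
    by (auto dest: dvd_imp_le)
  then show "(a + s) mod k + 1 \<noteq> (b + s) mod k + 1"
    using \<open>a < b\<close> mod_eq_dvd_iff_nat[of "a + s" "b + s" k] by auto
qed

lemma color_shift_image: "(\<lambda>a. (a + s) mod k + 1) ` {1..k::nat} = {1..k}"
proof (rule endo_inj_surj)
  show "(\<lambda>a. (a + s) mod k + 1) ` {1..k} \<subseteq> {1..k}"
    by (auto simp: Suc_le_eq)
qed (simp_all only: inj_on_color_shift finite_atLeastAtMost)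

text \<open>Each color class of the shifted coloring is a color class of the original one.\<close>

lemma card_shifted_color_class_eq:
  fixes k s :: nat
  assumes colors: "\<And>x. x \<in> S \<Longrightarrow> c x \<in> {1..k}"
    and balanced: "\<And>i j. i \<in> {1..k} \<Longrightarrow> j \<in> {1..k} \<Longrightarrow>
      card {x \<in> S. c x = i} = card {x \<in> S. c x = j}"
    and "i \<in> {1..k}" and "j \<in> {1..k}"
  shows "card {x \<in> S. (c x + s) mod k + 1 = i} = card {x \<in> S. (c x + s) mod k + 1 = j}"
proof -
  have color_class: "\<exists>a\<in>{1..k}. {x \<in> S. (c x + s) mod k + 1 = b} = {x \<in> S. c x = a}"
    if "b \<in> {1..k}" for b
  proof -
    from that obtain a where a: "a \<in> {1..k}" "b = (a + s) mod k + 1"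
      using color_shift_image[of s k] by blast
    have "(c x + s) mod k + 1 = b \<longleftrightarrow> c x = a" if "x \<in> S" for x
      using inj_on_eq_iff[OF inj_on_color_shift[of s k] colors[OF that] a(1)] a(2) by simp
    then show ?thesis
      using a(1) by blast
  qed
  show ?thesis
  proof -
    obtain a b where "a \<in> {1..k}" "b \<in> {1..k}"
      and "{x \<in> S. (c x + s) mod k + 1 = i} = {x \<in> S. c x = a}"
      and "{x \<in> S. (c x + s) mod k + 1 = j} = {x \<in> S. c x = b}"
      using color_class[OF \<open>i \<in> {1..k}\<close>] color_class[OF \<open>j \<in> {1..k}\<close>] by blast
    then show ?thesis
      using balanced[of a b] by (simp only:)
  qed
qed

lemma card_shifted_color_class_neighbors_eq:
  assumes f: "neighborhood_balanced_coloring k F f" and t: "t \<in> pverts F"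
    and ij: "i \<in> {1..k}" "j \<in> {1..k}"
  shows "card {z \<in> neighbors F t. (f z + s) mod k + 1 = i} =
    card {z \<in> neighbors F t. (f z + s) mod k + 1 = j}"
proof (rule card_shifted_color_class_eq[OF _ _ ij])
  show "f z \<in> {1..k}" if "z \<in> neighbors F t" for z
    using f that unfolding neighborhood_balanced_coloring_def neighbors_def by blast
  show "card {z \<in> neighbors F t. f z = a} = card {z \<in> neighbors F t. f z = b}"
    if "a \<in> {1..k}" "b \<in> {1..k}" for a b
    using f t that unfolding neighborhood_balanced_coloring_def by blast
qed

lemma neighbors_lex_product:
  assumes "u \<in> pverts G" and "v \<in> pverts H"
  shows "neighbors (lex_product G H) (u, v) =
    neighbors G u \<times> pverts H \<union> {u} \<times> neighbors H v"
  using assms by (auto simp: neighbors_def lex_product_def)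

lemma card_filter_neighbors_lex_product:
  assumes "pair_graph G" and "pair_graph H"
    and "u \<in> pverts G" and "v \<in> pverts H"
  shows "card {w \<in> neighbors (lex_product G H) (u, v). P w} =
    (\<Sum>y\<in>pverts H. card {x \<in> neighbors G u. P (x, y)}) + card {y \<in> neighbors H v. P (u, y)}"
proof -
  interpret G: pair_graph G by fact
  interpret H: pair_graph H by fact
  have finG: "finite (neighbors G u)" and finH: "finite (neighbors H v)"
    using G.pair_finite_verts H.pair_finite_verts by (auto simp: neighbors_def)
  let ?A = "Sigma (pverts H) (\<lambda>y. {x \<in> neighbors G u. P (x, y)})"
  let ?B = "{y \<in> neighbors H v. P (u, y)}"
  have split: "{w \<in> neighbors (lex_product G H) (u, v). P w} = prod.swap ` ?A \<union> Pair u ` ?B"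
    unfolding neighbors_lex_product[OF assms(3,4)] by (auto simp: image_iff)
  \<comment> \<open>The two parts are disjoint because \<open>G\<close> has no loops.\<close>
  have "u \<notin> neighbors G u"
    using G.pair_no_loops by (fastforce simp: neighbors_def)
  then have "prod.swap ` ?A \<inter> Pair u ` ?B = {}"
    by auto
  moreover have "finite ?A"
    using finG H.pair_finite_verts by auto
  ultimately have "card (prod.swap ` ?A \<union> Pair u ` ?B) = card (prod.swap ` ?A) + card (Pair u ` ?B)"
    using finH by (intro card_Un_disjoint) auto
  also have "card (prod.swap ` ?A) = card ?A"
    by (intro card_image) simp
  also have "card ?A = (\<Sum>y\<in>pverts H. card {x \<in> neighbors G u. P (x, y)})"
    using finG H.pair_finite_verts by (intro card_SigmaI) auto
  also have "card (Pair u ` ?B) = card ?B"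
    by (intro card_image) (simp add: inj_on_def)
  finally show ?thesis
    unfolding split .
qed

theorem theorem3p1:
  fixes G :: "'a pair_pre_digraph" and H :: "'b pair_pre_digraph" and k :: nat
  assumes "k \<ge> 2"
    and "pair_graph G" and "pair_graph H"
    and "admits_neighborhood_balanced_coloring k G"
    and "admits_neighborhood_balanced_coloring k H"
  shows "admits_neighborhood_balanced_coloring k (lex_product G H)"
proof -
  obtain g h where g: "neighborhood_balanced_coloring k G g"
    and h: "neighborhood_balanced_coloring k H h"
    using assms(4,5) unfolding admits_neighborhood_balanced_coloring_def by blast
  \<comment> \<open>The summand 1 moves the residues \<open>{0..<k}\<close> to the color set \<open>{1..k}\<close>.\<close>
  define c where "c = (\<lambda>(x, y). (g x + h y) mod k + 1)"
  have "neighborhood_balanced_coloring k (lex_product G H) c"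
    unfolding neighborhood_balanced_coloring_def
  proof (intro conjI ballI)
    fix w
    show "c w \<in> {1..k}"
      using \<open>k \<ge> 2\<close> by (auto simp: c_def Suc_le_eq split: prod.split)
  next
    fix w i j
    assume "w \<in> pverts (lex_product G H)" and ij: "i \<in> {1..k}" "j \<in> {1..k}"
    then obtain u v where w: "w = (u, v)" and u: "u \<in> pverts G" and v: "v \<in> pverts H"
      by (auto simp: lex_product_def)
    have colG: "card {x \<in> neighbors G u. c (x, y) = i} = card {x \<in> neighbors G u. c (x, y) = j}"
      for y
      using card_shifted_color_class_neighbors_eq[OF g u ij, of "h y"] by (simp add: c_def)
    have colH: "card {y \<in> neighbors H v. c (u, y) = i} = card {y \<in> neighbors H v. c (u, y) = j}"
      using card_shifted_color_class_neighbors_eq[OF h v ij, of "g u"]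
      by (simp add: c_def add.commute)
    show "card {z \<in> neighbors (lex_product G H) w. c z = i} =
        card {z \<in> neighbors (lex_product G H) w. c z = j}"
      unfolding w card_filter_neighbors_lex_product[OF assms(2,3) u v] colG colH ..
  qed
  then show ?thesis
    unfolding admits_neighborhood_balanced_coloring_def by blast
qed

end
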